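(* Let $F=2C_0+C_1+C_2+C_3+C_4$ be a singular fiber of Kodaira type $I_0^*$ of an elliptic fibration $g\colon X\to\mathbb P^1$ on a smooth $K3$ surface $X$, where $C_0$ is the unique component meeting four other components. Let $R$ be an ADER in $F$. Then $R$ is one of the following types: $$D_4,\qquad A_3,\qquad A_2,\qquad A_1^{\oplus s}\ (1\leq s\leq4).$$ More precisely: (1) If $C_0\subset R$, then $R$ is connected and is of type $D_4$ or $A_t$ with $1\leq t\leq3$. (2) If $C_0\not\subset R$, then $R$ is a disjoint union of leaves (components among $C_1,\dots,C_4$), hence is of type $A_1^{\oplus s}$ with $1\leq s\leq4$. Conversely, every configuration listed above occurs.
   Context: We work over an algebraically closed field of characteristic $0$. In a fiber of type $I_0^*$ all components $C_0,\dots,C_4$ are smooth rational $(-2)$-curves; $C_1,\dots,C_4$ are pairwise disjoint and each meets $C_0$ transversely at one point (dual graph $\widetilde D_4$). An ADE reduced divisor (ADER) in a singular fiber $F$ is a nonzero reduced subdivisor of $F$ (i.e. a sum of distinct components) consisting of smooth rational $(-2)$-curves whose dual graph (vertices: components; two vertices joined by as many edges as the intersection number) is a disjoint union of Dynkin diagrams of type $A_k$, $D_l$ ($l\ge4$), $E_6,E_7,E_8$. Its type is the type of this graph; $\oplus$ denotes disjoint union and $A_1^{\oplus s}$ is the disjoint union of $s$ copies of $A_1$. *)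

theory Defs
  imports
    "HOL-Analysis.Analysis"
    "HOL-Library.Poly_Mapping"
    "HOL-Library.Extended_Nat"
    "HOL-Library.Multiset"
begin

text \<open>
  Classical (closed-point) algebraic geometry of projective varieties over an algebraically closed
  field of characteristic 0. That is the sort \<open>{alg_closed_field, field_char_0}\<close>; it is imposed in
  the theorem, the definitions only need a field. Every smooth proper surface is projective, so
  working with subvarieties of projective spaces is no restriction for K3 surfaces.
\<close>


section \<open>Projective space and its Zariski topology\<close>

text \<open>Polynomials in the variables \<open>x\<^sub>0, x\<^sub>1, \<dots>\<close>; a monomial is a finitely supported exponent vector.\<close>

type_synonym 'k mvpoly = "(nat \<Rightarrow>\<^sub>0 nat) \<Rightarrow>\<^sub>0 'k"

definition eval_poly :: "'k::field mvpoly \<Rightarrow> (nat \<Rightarrow> 'k) \<Rightarrow> 'k" where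
  "eval_poly F v =
     (\<Sum>m\<in>Poly_Mapping.keys F. Poly_Mapping.lookup F m *
        (\<Prod>i\<in>Poly_Mapping.keys m. v i ^ Poly_Mapping.lookup m i))"

definition homogeneous :: "nat \<Rightarrow> 'k::field mvpoly \<Rightarrow> bool" where
  "homogeneous d F \<longleftrightarrow>
     (\<forall>m\<in>Poly_Mapping.keys F. (\<Sum>i\<in>Poly_Mapping.keys m. Poly_Mapping.lookup m i) = d)"

text \<open>A point is the set of all its homogeneous coordinate vectors. All the spaces \<open>\<P>\<^sup>N\<close> live in one
  ambient space: \<open>\<P>\<^sup>N\<close> is cut out by \<open>x\<^sub>i = 0\<close> for \<open>i > N\<close>, and its Zariski topology is the subspace
  topology.\<close>

type_synonym 'k pt = "(nat \<Rightarrow> 'k) set"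

definition proj_point :: "(nat \<Rightarrow> 'k::field) \<Rightarrow> 'k pt" where
  "proj_point v = {\<lambda>i. c * v i | c. c \<noteq> 0}"

definition proj_points :: "'k::field pt set" where
  "proj_points = {proj_point v | v. v \<noteq> (\<lambda>_. 0)}"

definition proj_space :: "nat \<Rightarrow> 'k::field pt set" where
  "proj_space N = {proj_point v | v. v \<noteq> (\<lambda>_. 0) \<and> (\<forall>i>N. v i = 0)}"

definition nonvanishing :: "'k::field mvpoly \<Rightarrow> 'k pt set" where
  "nonvanishing F = {p \<in> proj_points. \<forall>v\<in>p. eval_poly F v \<noteq> 0}"

definition zariski :: "'k::field pt topology" where
  "zariski = topology_generated_by {nonvanishing F | F. \<exists>d. homogeneous d F}"

abbreviation zariski_on :: "'k::field pt set \<Rightarrow> 'k pt topology" where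
  "zariski_on X \<equiv> subtopology zariski X"

definition irreducible_set :: "'k::field pt set \<Rightarrow> bool" where
  "irreducible_set Z \<longleftrightarrow> Z \<noteq> {} \<and>
     (\<forall>A B. closedin zariski A \<and> closedin zariski B \<and> Z \<subseteq> A \<union> B \<longrightarrow> Z \<subseteq> A \<or> Z \<subseteq> B)"

definition krull_dim :: "'k::field pt set \<Rightarrow> enat" where
  "krull_dim X = Sup {enat n | n. \<exists>Z. (\<forall>i\<le>n. irreducible_set (Z i) \<and> closedin (zariski_on X) (Z i))
                                  \<and> (\<forall>i<n. Z i \<subset> Z (Suc i))}"

definition projective_variety :: "'k::field pt set \<Rightarrow> bool" where
  "projective_variety X \<longleftrightarrow>
     (\<exists>N. X \<subseteq> proj_space N) \<and> closedin zariski X \<and> irreducible_set X"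


section \<open>Regular functions, local rings, morphisms\<close>

text \<open>\<open>f\<close> is regular on \<open>U\<close>: locally a quotient of homogeneous polynomials of the same degree.
  Values of \<open>f\<close> outside \<open>U\<close> are irrelevant.\<close>

definition regular_on :: "'k::field pt set \<Rightarrow> ('k pt \<Rightarrow> 'k) \<Rightarrow> bool" where
  "regular_on U f \<longleftrightarrow>
     (\<forall>p\<in>U. \<exists>W F G d. openin zariski W \<and> p \<in> W \<and> homogeneous d F \<and> homogeneous d G \<and>
        (\<forall>q\<in>U \<inter> W. \<forall>v\<in>q. eval_poly G v \<noteq> 0 \<and> f q = eval_poly F v / eval_poly G v))"

text \<open>\<open>near_set X p U\<close>: \<open>U\<close> is an open neighbourhood of \<open>p\<close> in \<open>X\<close>. Elements of the local ring
  \<open>\<O>\<^sub>X\<^sub>,\<^sub>p\<close> are represented by functions that are regular near \<open>p\<close> and arbitrary elsewhere; two of them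
  represent the same germ iff they are \<open>eq_near\<close>. All ideals below are unions of germ classes.\<close>

definition near_set :: "'k::field pt set \<Rightarrow> 'k pt \<Rightarrow> 'k pt set \<Rightarrow> bool" where
  "near_set X p U \<longleftrightarrow> openin (zariski_on X) U \<and> p \<in> U"

definition eq_near :: "'k::field pt set \<Rightarrow> 'k pt \<Rightarrow> ('k pt \<Rightarrow> 'k) \<Rightarrow> ('k pt \<Rightarrow> 'k) \<Rightarrow> bool" where
  "eq_near X p f h \<longleftrightarrow> (\<exists>U. near_set X p U \<and> (\<forall>q\<in>U. f q = h q))"

definition local_ring :: "'k::field pt set \<Rightarrow> 'k pt \<Rightarrow> ('k pt \<Rightarrow> 'k) set" where
  "local_ring X p = {f. \<exists>U. near_set X p U \<and> regular_on U f}"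

definition max_ideal :: "'k::field pt set \<Rightarrow> 'k pt \<Rightarrow> ('k pt \<Rightarrow> 'k) set" where
  "max_ideal X p = {f \<in> local_ring X p. f p = 0}"

definition max_ideal_sq :: "'k::field pt set \<Rightarrow> 'k pt \<Rightarrow> ('k pt \<Rightarrow> 'k) set" where
  "max_ideal_sq X p = {h. \<exists>(n::nat) a b. (\<forall>i<n. a i \<in> max_ideal X p \<and> b i \<in> max_ideal X p) \<and>
                                         h = (\<lambda>q. \<Sum>i<n. a i q * b i q)}"

text \<open>\<open>dim\<^sub>k (A / I)\<close> for linear subspaces \<open>I \<subseteq> A\<close> of a function space: the least size of a spanning
  set modulo \<open>I\<close>, and \<open>\<infinity>\<close> if there is no finite one.\<close>

definition codim :: "('i \<Rightarrow> 'k::field) set \<Rightarrow> ('i \<Rightarrow> 'k) set \<Rightarrow> enat" where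
  "codim A I = Inf {enat (card B) | B. finite B \<and> B \<subseteq> A \<and>
                      (\<forall>a\<in>A. \<exists>c. (\<lambda>x. a x - (\<Sum>b\<in>B. c b * b x)) \<in> I)}"

definition smooth_variety :: "'k::field pt set \<Rightarrow> bool" where
  "smooth_variety X \<longleftrightarrow> projective_variety X \<and>
     (\<forall>p\<in>X. codim (max_ideal X p) (max_ideal_sq X p) = krull_dim X)"

definition morphism :: "'k::field pt set \<Rightarrow> 'k pt set \<Rightarrow> ('k pt \<Rightarrow> 'k pt) \<Rightarrow> bool" where
  "morphism X Y \<phi> \<longleftrightarrow> continuous_map (zariski_on X) (zariski_on Y) \<phi> \<and>
     (\<forall>V f. openin (zariski_on Y) V \<and> regular_on V f \<longrightarrow> regular_on {p \<in> X. \<phi> p \<in> V} (f \<circ> \<phi>))"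

definition isomorphic_varieties :: "'k::field pt set \<Rightarrow> 'k pt set \<Rightarrow> bool" where
  "isomorphic_varieties X Y \<longleftrightarrow>
     (\<exists>\<phi> \<psi>. morphism X Y \<phi> \<and> morphism Y X \<psi> \<and> (\<forall>p\<in>X. \<psi> (\<phi> p) = p) \<and> (\<forall>q\<in>Y. \<phi> (\<psi> q) = q))"

definition birational :: "'k::field pt set \<Rightarrow> 'k pt set \<Rightarrow> bool" where
  "birational X Y \<longleftrightarrow>
     (\<exists>U V. openin (zariski_on X) U \<and> U \<noteq> {} \<and> openin (zariski_on Y) V \<and> V \<noteq> {} \<and>
            isomorphic_varieties U V)"


section \<open>Cohomology of the structure sheaf, K3 surfaces, elliptic fibrations\<close>

text \<open>\<open>h\<^sup>1(X, \<O>\<^sub>X)\<close> is computed by \<open>\<C>\<close>ech cohomology for the standard affine cover \<open>X \<inter> {x\<^sub>i \<noteq> 0}\<close>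
  (the members with \<open>i > N\<close> are empty). The cochain component on \<open>U\<^sub>i \<inter> U\<^sub>j\<close> is \<open>f (i, j, \<cdot>)\<close>; its values
  outside \<open>U\<^sub>i \<inter> U\<^sub>j\<close> are unconstrained and are divided out with the coboundaries.\<close>

definition affine_chart :: "'k::field pt set \<Rightarrow> nat \<Rightarrow> 'k pt set" where
  "affine_chart X i = {p \<in> X. \<forall>v\<in>p. v i \<noteq> 0}"

definition cech_cocycles :: "'k::field pt set \<Rightarrow> (nat \<times> nat \<times> 'k pt \<Rightarrow> 'k) set" where
  "cech_cocycles X =
     {f. (\<forall>i j. regular_on (affine_chart X i \<inter> affine_chart X j) (\<lambda>p. f (i, j, p))) \<and>
         (\<forall>i j l. \<forall>p \<in> affine_chart X i \<inter> affine_chart X j \<inter> affine_chart X l.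
            f (i, l, p) = f (i, j, p) + f (j, l, p))}"

definition cech_coboundaries :: "'k::field pt set \<Rightarrow> (nat \<times> nat \<times> 'k pt \<Rightarrow> 'k) set" where
  "cech_coboundaries X =
     {f. \<exists>h. (\<forall>i. regular_on (affine_chart X i) (h i)) \<and>
         (\<forall>i j. \<forall>p \<in> affine_chart X i \<inter> affine_chart X j. f (i, j, p) = h j p - h i p)}"

definition h1_structure_sheaf :: "'k::field pt set \<Rightarrow> enat" where
  "h1_structure_sheaf X = codim (cech_cocycles X) (cech_coboundaries X)"

text \<open>The Zariski tangent space, as derivations of the local ring into the residue field. (The Leibniz
  rule forces a derivation to depend on the germ only.)\<close>

definition tangent_space :: "'k::field pt set \<Rightarrow> 'k pt \<Rightarrow> (('k pt \<Rightarrow> 'k) \<Rightarrow> 'k) set" where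
  "tangent_space X p =
     {\<delta>. (\<forall>f\<in>local_ring X p. \<forall>h\<in>local_ring X p.
            \<delta> (\<lambda>q. f q + h q) = \<delta> f + \<delta> h \<and> \<delta> (\<lambda>q. f q * h q) = f p * \<delta> h + h p * \<delta> f) \<and>
         (\<forall>f\<in>local_ring X p. \<forall>c. \<delta> (\<lambda>q. c * f q) = c * \<delta> f) \<and>
         (\<forall>f. f \<notin> local_ring X p \<longrightarrow> \<delta> f = 0)}"

text \<open>A regular 2-form, as a family of alternating forms on the tangent spaces that is locally a sum
  \<open>\<Sum>\<^sub>i a\<^sub>i df\<^sub>i \<and> dh\<^sub>i\<close> with regular \<open>a\<^sub>i, f\<^sub>i, h\<^sub>i\<close>.\<close>

definition regular_2form ::
  "'k::field pt set \<Rightarrow> ('k pt \<Rightarrow> (('k pt \<Rightarrow> 'k) \<Rightarrow> 'k) \<Rightarrow> (('k pt \<Rightarrow> 'k) \<Rightarrow> 'k) \<Rightarrow> 'k) \<Rightarrow> bool" where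
  "regular_2form X \<omega> \<longleftrightarrow>
     (\<forall>p\<in>X. \<exists>U (n::nat) a f h. near_set X p U \<and>
        (\<forall>i<n. regular_on U (a i) \<and> regular_on U (f i) \<and> regular_on U (h i)) \<and>
        (\<forall>q\<in>U. \<forall>\<delta>\<in>tangent_space X q. \<forall>\<epsilon>\<in>tangent_space X q.
           \<omega> q \<delta> \<epsilon> = (\<Sum>i<n. a i q * (\<delta> (f i) * \<epsilon> (h i) - \<delta> (h i) * \<epsilon> (f i)))))"

text \<open>\<open>\<omega>\<^sub>X \<cong> \<O>\<^sub>X\<close> on a smooth surface: there is a nowhere vanishing regular 2-form.\<close>

definition trivial_canonical_bundle :: "'k::field pt set \<Rightarrow> bool" where
  "trivial_canonical_bundle X \<longleftrightarrow>
     (\<exists>\<omega>. regular_2form X \<omega> \<and>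
          (\<forall>p\<in>X. \<exists>\<delta>\<in>tangent_space X p. \<exists>\<epsilon>\<in>tangent_space X p. \<omega> p \<delta> \<epsilon> \<noteq> 0))"

definition K3_surface :: "'k::field pt set \<Rightarrow> bool" where
  "K3_surface X \<longleftrightarrow> smooth_variety X \<and> krull_dim X = 2 \<and>
     trivial_canonical_bundle X \<and> h1_structure_sheaf X = 0"

definition set_fiber :: "'k::field pt set \<Rightarrow> ('k pt \<Rightarrow> 'k pt) \<Rightarrow> 'k pt \<Rightarrow> 'k pt set" where
  "set_fiber X g b = {p \<in> X. g p = b}"

text \<open>A surjective morphism to \<open>\<P>\<^sup>1\<close> whose fibers over all but finitely many points are smooth
  irreducible curves of genus \<open>h\<^sup>1(\<O>) = 1\<close>. In characteristic 0 the general scheme-theoretic fiber is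
  reduced, so it may be treated as a set here. No section is required.\<close>

definition elliptic_fibration :: "'k::field pt set \<Rightarrow> ('k pt \<Rightarrow> 'k pt) \<Rightarrow> bool" where
  "elliptic_fibration X g \<longleftrightarrow> morphism X (proj_space 1) g \<and> g ` X = proj_space 1 \<and>
     finite {b \<in> proj_space 1.
       \<not> (smooth_variety (set_fiber X g b) \<and> krull_dim (set_fiber X g b) = 1 \<and>
          h1_structure_sheaf (set_fiber X g b) = 1)}"


section \<open>Curves on a smooth surface: orders of vanishing and intersection numbers\<close>

definition curve_on :: "'k::field pt set \<Rightarrow> 'k pt set \<Rightarrow> bool" where
  "curve_on X D \<longleftrightarrow> projective_variety D \<and> krull_dim D = 1 \<and> D \<subseteq> X"

definition ideal_at :: "'k::field pt set \<Rightarrow> 'k pt set \<Rightarrow> 'k pt \<Rightarrow> ('k pt \<Rightarrow> 'k) set" where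
  "ideal_at X D p = {f \<in> local_ring X p. \<exists>U. near_set X p U \<and> (\<forall>q\<in>U \<inter> D. f q = 0)}"

text \<open>\<open>f\<close> generates the ideal of \<open>D\<close> in the local ring of \<open>X\<close> at \<open>p\<close>.\<close>

definition local_equation ::
  "'k::field pt set \<Rightarrow> 'k pt set \<Rightarrow> 'k pt \<Rightarrow> ('k pt \<Rightarrow> 'k) \<Rightarrow> bool" where
  "local_equation X D p f \<longleftrightarrow> f \<in> local_ring X p \<and>
     ideal_at X D p =
       {h \<in> local_ring X p. \<exists>a\<in>local_ring X p. eq_near X p h (\<lambda>q. a q * f q)}"

text \<open>Order of vanishing along \<open>D\<close> of a function \<open>h\<close> regular near \<open>p \<in> D\<close> (and not identically 0 there):
  the largest \<open>n\<close> such that the \<open>n\<close>-th power of a local equation of \<open>D\<close> divides \<open>h\<close>. It does not depend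
  on \<open>p\<close>, since the local ring is factorial and the local equation is prime.\<close>

definition order_at :: "'k::field pt set \<Rightarrow> 'k pt set \<Rightarrow> 'k pt \<Rightarrow> ('k pt \<Rightarrow> 'k) \<Rightarrow> nat" where
  "order_at X D p h = (GREATEST n. \<exists>f a. local_equation X D p f \<and> a \<in> local_ring X p \<and>
                                         eq_near X p h (\<lambda>q. a q * f q ^ n))"

text \<open>\<open>dim\<^sub>k \<O>\<^sub>X\<^sub>,\<^sub>p / (I\<^sub>C + I\<^sub>D)\<close>, and its sum over all points for distinct curves.\<close>

definition local_intersection :: "'k::field pt set \<Rightarrow> 'k pt set \<Rightarrow> 'k pt set \<Rightarrow> 'k pt \<Rightarrow> enat" where
  "local_intersection X C D p =
     codim (local_ring X p) {\<lambda>q. u q + v q | u v. u \<in> ideal_at X C p \<and> v \<in> ideal_at X D p}"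

definition proper_intersection :: "'k::field pt set \<Rightarrow> 'k pt set \<Rightarrow> 'k pt set \<Rightarrow> nat" where
  "proper_intersection X C D = (\<Sum>p\<in>C \<inter> D. the_enat (local_intersection X C D p))"

text \<open>Order along \<open>D\<close> of a homogeneous polynomial \<open>G\<close>: locally divide by a nonvanishing homogeneous
  polynomial of the same degree.\<close>

definition form_quotient :: "'k::field mvpoly \<Rightarrow> 'k mvpoly \<Rightarrow> 'k pt \<Rightarrow> 'k" where
  "form_quotient G M q = (let v = SOME v. v \<in> q in eval_poly G v / eval_poly M v)"

definition form_order :: "'k::field pt set \<Rightarrow> 'k pt set \<Rightarrow> 'k mvpoly \<Rightarrow> nat" where
  "form_order X D G =
     (THE n. \<forall>p\<in>D. \<forall>d M. homogeneous d G \<and> homogeneous d M \<and> p \<in> nonvanishing M \<longrightarrow>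
               order_at X D p (form_quotient G M) = n)"

text \<open>Self-intersection by moving \<open>C\<close> in its linear equivalence class: choose a rational function
  \<open>G/H\<close> on \<open>X\<close> with order 1 along \<open>C\<close>. Then \<open>C\<close> is linearly equivalent to \<open>C - div (G/H)\<close>, a divisor
  not containing \<open>C\<close>, with which \<open>C\<close> is intersected curve by curve. The result does not depend on
  \<open>G\<close> and \<open>H\<close>.\<close>

definition self_intersection :: "'k::field pt set \<Rightarrow> 'k pt set \<Rightarrow> int" where
  "self_intersection X C =
     (THE n. \<exists>G H d. homogeneous d G \<and> homogeneous d H \<and>
        X \<inter> nonvanishing G \<noteq> {} \<and> X \<inter> nonvanishing H \<noteq> {} \<and>
        form_order X C G = form_order X C H + 1 \<and>
        n = (\<Sum>D | curve_on X D \<and> D \<noteq> C \<and> form_order X D G \<noteq> form_order X D H.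
               (int (form_order X D H) - int (form_order X D G)) * int (proper_intersection X C D)))"

definition intersection_number :: "'k::field pt set \<Rightarrow> 'k pt set \<Rightarrow> 'k pt set \<Rightarrow> int" where
  "intersection_number X C D =
     (if C = D then self_intersection X C else int (proper_intersection X C D))"

definition smooth_rational_curve_on :: "'k::field pt set \<Rightarrow> 'k pt set \<Rightarrow> bool" where
  "smooth_rational_curve_on X C \<longleftrightarrow>
     curve_on X C \<and> smooth_variety C \<and> birational C (proj_space 1)"

definition minus_two_curve :: "'k::field pt set \<Rightarrow> 'k pt set \<Rightarrow> bool" where
  "minus_two_curve X C \<longleftrightarrow> smooth_rational_curve_on X C \<and> intersection_number X C C = -2"

definition meet_transversely_once :: "'k::field pt set \<Rightarrow> 'k pt set \<Rightarrow> 'k pt set \<Rightarrow> bool" where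
  "meet_transversely_once X C D \<longleftrightarrow> (\<exists>p. C \<inter> D = {p} \<and> local_intersection X C D p = 1)"


section \<open>Effective divisors and fibers\<close>

text \<open>An effective divisor assigns to every curve its multiplicity.\<close>

type_synonym 'k divisor = "'k pt set \<Rightarrow> nat"

definition divisor_components :: "'k divisor \<Rightarrow> 'k pt set set" where
  "divisor_components E = {D. E D \<noteq> 0}"

definition divisor_support :: "'k divisor \<Rightarrow> 'k pt set" where
  "divisor_support E = \<Union>(divisor_components E)"

text \<open>The scheme-theoretic fiber \<open>g\<^sup>*(b)\<close>: the multiplicity of a curve \<open>D \<subseteq> g\<^sup>-\<^sup>1(b)\<close> is the order along \<open>D\<close>
  of the pullback of a local parameter of \<open>\<P>\<^sup>1\<close> at \<open>b\<close>.\<close>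

definition fiber_divisor :: "'k::field pt set \<Rightarrow> ('k pt \<Rightarrow> 'k pt) \<Rightarrow> 'k pt \<Rightarrow> 'k divisor" where
  "fiber_divisor X g b D =
     (if curve_on X D \<and> D \<subseteq> set_fiber X g b
      then THE n. \<forall>p\<in>D. \<forall>u. local_equation (proj_space 1) {b} b u \<longrightarrow> order_at X D p (u \<circ> g) = n
      else 0)"

text \<open>Type \<open>I\<^sub>0\<^sup>*\<close>: \<open>E = 2C\<^sub>0 + C\<^sub>1 + C\<^sub>2 + C\<^sub>3 + C\<^sub>4\<close> with dual graph the extended Dynkin diagram
  \<open>D\<^sub>4\<close>, the component \<open>C\<^sub>0\<close> being the one that meets the four others.\<close>

definition kodaira_I0_star :: "'k::field pt set \<Rightarrow> 'k divisor \<Rightarrow> (nat \<Rightarrow> 'k pt set) \<Rightarrow> bool" where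
  "kodaira_I0_star X E C \<longleftrightarrow>
     inj_on C {0..4} \<and>
     E = (\<lambda>D. 2 * of_bool (D = C 0) + (\<Sum>i=1..4. of_bool (D = C i))) \<and>
     (\<forall>i\<in>{0..4}. minus_two_curve X (C i)) \<and>
     (\<forall>i\<in>{1..4}. \<forall>j\<in>{1..4}. i \<noteq> j \<longrightarrow> C i \<inter> C j = {}) \<and>
     (\<forall>i\<in>{1..4}. meet_transversely_once X (C 0) (C i))"


section \<open>Dynkin diagrams and ADE reduced divisors\<close>

datatype dynkin = Dyn_A nat | Dyn_D nat | Dyn_E nat

fun dynkin_rank :: "dynkin \<Rightarrow> nat" where
  "dynkin_rank (Dyn_A k) = k"
| "dynkin_rank (Dyn_D l) = l"
| "dynkin_rank (Dyn_E n) = n"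

fun valid_dynkin :: "dynkin \<Rightarrow> bool" where
  "valid_dynkin (Dyn_A k) \<longleftrightarrow> 1 \<le> k"
| "valid_dynkin (Dyn_D l) \<longleftrightarrow> 4 \<le> l"
| "valid_dynkin (Dyn_E n) \<longleftrightarrow> n \<in> {6, 7, 8}"

text \<open>Edges of the diagram on the vertices \<open>0, \<dots>, rank - 1\<close>. \<open>A\<^sub>k\<close> is a path. In \<open>D\<^sub>l\<close> and \<open>E\<^sub>n\<close> the
  vertices other than the last one form a path; the last one is attached to the second vertex from the
  end of the path for \<open>D\<^sub>l\<close>, and to the third one from the beginning for \<open>E\<^sub>n\<close>.\<close>

fun dynkin_arc :: "dynkin \<Rightarrow> nat \<Rightarrow> nat \<Rightarrow> bool" where
  "dynkin_arc (Dyn_A k) v w \<longleftrightarrow> w = v + 1 \<and> w < k"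
| "dynkin_arc (Dyn_D l) v w \<longleftrightarrow> w = v + 1 \<and> w < l - 1 \<or> v = l - 3 \<and> w = l - 1"
| "dynkin_arc (Dyn_E n) v w \<longleftrightarrow> w = v + 1 \<and> w < n - 1 \<or> v = 2 \<and> w = n - 1"

text \<open>Disjoint union of a list of diagrams; the vertex \<open>(i, v)\<close> is the vertex \<open>v\<close> of the \<open>i\<close>-th one.\<close>

definition union_vertices :: "dynkin list \<Rightarrow> (nat \<times> nat) set" where
  "union_vertices ts = {(i, v). i < length ts \<and> v < dynkin_rank (ts ! i)}"

definition union_edges :: "dynkin list \<Rightarrow> nat \<times> nat \<Rightarrow> nat \<times> nat \<Rightarrow> int" where
  "union_edges ts = (\<lambda>(i, v) (j, w).
     of_bool (i = j \<and> (dynkin_arc (ts ! i) v w \<or> dynkin_arc (ts ! i) w v)))"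

text \<open>The loop-free multigraph with vertex set \<open>V\<close>, in which distinct \<open>x, y\<close> are joined by \<open>m x y\<close> edges,
  is isomorphic to the disjoint union of the Dynkin diagrams in the multiset \<open>T\<close>.\<close>

definition graph_has_type :: "'v set \<Rightarrow> ('v \<Rightarrow> 'v \<Rightarrow> int) \<Rightarrow> dynkin multiset \<Rightarrow> bool" where
  "graph_has_type V m T \<longleftrightarrow> (\<forall>t\<in>#T. valid_dynkin t) \<and>
     (\<exists>ts \<phi>. mset ts = T \<and> bij_betw \<phi> (union_vertices ts) V \<and>
        (\<forall>x\<in>union_vertices ts. \<forall>y\<in>union_vertices ts. x \<noteq> y \<longrightarrow>
           m (\<phi> x) (\<phi> y) = union_edges ts x y))"

definition divisor_has_type :: "'k::field pt set \<Rightarrow> 'k divisor \<Rightarrow> dynkin multiset \<Rightarrow> bool" where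
  "divisor_has_type X R T \<longleftrightarrow> graph_has_type (divisor_components R) (intersection_number X) T"

definition ADER :: "'k::field pt set \<Rightarrow> 'k divisor \<Rightarrow> 'k divisor \<Rightarrow> bool" where
  "ADER X E R \<longleftrightarrow>
     R \<noteq> (\<lambda>_. 0) \<and> (\<forall>D. R D \<le> 1 \<and> R D \<le> E D) \<and>
     (\<forall>D\<in>divisor_components R. minus_two_curve X D) \<and>
     (\<exists>T. divisor_has_type X R T)"

end

(* In an I0* fiber, two distinct leaves have intersection number 0 and each of them has intersection
   number 1 with C 0. So a reduced subdivisor without C 0 has a discrete dual graph, and one with C 0
   has a star as its dual graph. A star with at most three leaves is A_1, A_2, A_3 or D_4. Four
   leaves are impossible, because no vertex of an ADE diagram has more than three neighbours. *)

theory Submission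
  imports Defs
begin

section \<open>Dynkin types of discrete graphs and stars\<close>

text \<open>\<open>A_1\<close> has the single vertex \<open>0\<close> and no arc, so the vertices of
  \<open>card L\<close> copies are the pairs \<open>(i, 0)\<close>, and any numbering of
  \<open>L\<close> composed with \<open>fst\<close> is the required isomorphism. For empty
  \<open>L\<close> the type is the empty multiset.\<close>

lemma graph_has_type_discrete:
  assumes "finite L" and m: "\<And>x y. x \<in> L \<Longrightarrow> y \<in> L \<Longrightarrow> x \<noteq> y \<Longrightarrow> m x y = 0"
  shows "graph_has_type L m (replicate_mset (card L) (Dyn_A 1))"
proof -
  obtain f where f: "bij_betw f {..<card L} L"
    using ex_bij_betw_nat_finite[OF \<open>finite L\<close>] by (auto simp: atLeast0LessThan)
  let ?ts = "replicate (card L) (Dyn_A 1)"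
  have V: "union_vertices ?ts = {..<card L} \<times> {0}"
    by (auto simp: union_vertices_def)
  have "bij_betw fst ({..<card L} \<times> {0::nat}) {..<card L}"
    by (auto simp: bij_betw_def inj_on_def)
  then have bij: "bij_betw (f \<circ> fst) (union_vertices ?ts) L"
    unfolding V using f by (rule bij_betw_trans)
  have "m ((f \<circ> fst) x) ((f \<circ> fst) y) = union_edges ?ts x y"
    if "x \<in> union_vertices ?ts" "y \<in> union_vertices ?ts" "x \<noteq> y" for x y
  proof -
    have "(f \<circ> fst) x \<in> L" "(f \<circ> fst) y \<in> L" "(f \<circ> fst) x \<noteq> (f \<circ> fst) y"
      using bij_betwE[OF bij] that inj_onD[OF bij_betw_imp_inj_on[OF bij], of x y] by blast+
    then show ?thesis
      using that[unfolded V] m by (auto simp: union_edges_def)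
  qed
  with bij show ?thesis
    unfolding graph_has_type_def
    by (intro conjI exI[of _ ?ts] exI[of _ "f \<circ> fst"]) (auto split: if_splits)
qed

text \<open>With only one diagram the component index is always \<open>0\<close>, so
  \<open>snd\<close> forgets it. What remains to be given is a numbering of \<open>V\<close> by the
  vertices of \<open>t\<close> itself.\<close>

lemma graph_has_type_single:
  assumes "valid_dynkin t" and f: "bij_betw f {..<dynkin_rank t} V"
    and m: "\<And>v w. v < dynkin_rank t \<Longrightarrow> w < dynkin_rank t \<Longrightarrow> v \<noteq> w \<Longrightarrow>
              m (f v) (f w) = of_bool (dynkin_arc t v w \<or> dynkin_arc t w v)"
  shows "graph_has_type V m {#t#}"
proof -
  have V: "union_vertices [t] = {0} \<times> {..<dynkin_rank t}"
    by (auto simp: union_vertices_def)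
  have "bij_betw snd ({0::nat} \<times> {..<dynkin_rank t}) {..<dynkin_rank t}"
    by (auto simp: bij_betw_def inj_on_def image_iff)
  then have "bij_betw (f \<circ> snd) (union_vertices [t]) V"
    unfolding V using f by (rule bij_betw_trans)
  moreover have "\<forall>x\<in>union_vertices [t]. \<forall>y\<in>union_vertices [t]. x \<noteq> y \<longrightarrow>
           m ((f \<circ> snd) x) ((f \<circ> snd) y) = union_edges [t] x y"
    using m by (auto simp: V union_edges_def)
  ultimately show ?thesis
    unfolding graph_has_type_def using assms(1)
    by (intro conjI exI[of _ "[t]"] exI[of _ "f \<circ> snd"]) auto
qed

text \<open>A list serves as the numbering, so that an explicit small graph can be checked entry by
  entry. The order of the list has to match the vertex order built into
  \<open>dynkin_arc\<close>.\<close>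

lemma graph_has_type_list:
  assumes "valid_dynkin t" and "distinct xs" and "length xs = dynkin_rank t"
    and "\<And>v w. v < dynkin_rank t \<Longrightarrow> w < dynkin_rank t \<Longrightarrow> v \<noteq> w \<Longrightarrow>
           m (xs ! v) (xs ! w) = of_bool (dynkin_arc t v w \<or> dynkin_arc t w v)"
  shows "graph_has_type (set xs) m {#t#}"
  using assms bij_betw_nth[OF assms(2) refl refl]
  by (intro graph_has_type_single[where f = "nth xs"]) auto

lemma graph_has_type_star:
  assumes "finite L" and "card L \<le> 3" and c: "c \<notin> L"
    and cL: "\<And>x. x \<in> L \<Longrightarrow> m c x = 1 \<and> m x c = 1"
    and LL: "\<And>x y. x \<in> L \<Longrightarrow> y \<in> L \<Longrightarrow> x \<noteq> y \<Longrightarrow> m x y = 0"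
  shows "graph_has_type (insert c L) m {#if card L = 3 then Dyn_D 4 else Dyn_A (card L + 1)#}"
proof -
  obtain xs where xs: "set xs = L" "distinct xs"
    using finite_distinct_list[OF \<open>finite L\<close>] by blast
  then have len: "length xs = card L"
    using distinct_card by fastforce
  consider "length xs = 0" | "length xs = 1" | "length xs = 2" | "length xs = 3"
    using len assms(2) by linarith
  then show ?thesis
  proof cases
    case 1
    then have "graph_has_type (set [c]) m {#Dyn_A 1#}"
      by (intro graph_has_type_list) auto
    with 1 xs len show ?thesis by simp
  next
    case 2
    then obtain x where x: "xs = [x]"
      by (auto simp: length_Suc_conv)
    then have L: "L = {x}" using xs by auto
    have "graph_has_type (set [c, x]) m {#Dyn_A 2#}"
      using c cL L by (intro graph_has_type_list) (auto simp: less_Suc_eq numeral_eq_Suc)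
    then show ?thesis by (simp add: L numeral_2_eq_2)
  next
    case 3
    then obtain x y where x: "xs = [x, y]"
      by (auto simp: length_Suc_conv numeral_eq_Suc)
    then have L: "L = {x, y}" "x \<noteq> y" using xs by auto
    \<comment> \<open>The centre is the middle vertex of the path, hence the entry at position
      1.\<close>
    have "graph_has_type (set [x, c, y]) m {#Dyn_A 3#}"
      using c cL LL L by (intro graph_has_type_list) (auto simp: less_Suc_eq numeral_eq_Suc)
    moreover have "set [x, c, y] = insert c L" "card L = 2"
      using L by auto
    ultimately show ?thesis by simp
  next
    case 4
    then obtain x y z where x: "xs = [x, y, z]"
      by (auto simp: length_Suc_conv numeral_eq_Suc)
    then have L: "L = {x, y, z}" "x \<noteq> y" "x \<noteq> z" "y \<noteq> z" using xs by auto
    \<comment> \<open>In \<open>Dyn_D 4\<close> the vertices 0, 1, 2 form a path and the last vertex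
      3 is attached to \<open>4 - 3 = 1\<close>. So the centre again goes to position 1, and the
      other three places may be filled by the leaves in any order.\<close>
    have "graph_has_type (set [x, c, y, z]) m {#Dyn_D 4#}"
    proof (rule graph_has_type_list)
      show "distinct [x, c, y, z]" using c L by auto
      have m: "m c x = 1" "m x c = 1" "m c y = 1" "m y c = 1" "m c z = 1" "m z c = 1"
        "m x y = 0" "m y x = 0" "m x z = 0" "m z x = 0" "m y z = 0" "m z y = 0"
        using cL LL L by blast+
      fix v w :: nat
      assume "v < dynkin_rank (Dyn_D 4)" "w < dynkin_rank (Dyn_D 4)" "v \<noteq> w"
      then have "v \<in> {0, 1, 2, 3}" "w \<in> {0, 1, 2, 3}" "v \<noteq> w" by auto
      then show "m ([x, c, y, z] ! v) ([x, c, y, z] ! w) =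
          of_bool (dynkin_arc (Dyn_D 4) v w \<or> dynkin_arc (Dyn_D 4) w v)"
        by (elim insertE emptyE) (simp_all add: m)
    qed auto
    moreover have "set [x, c, y, z] = insert c L" "card L = 3"
      using L by auto
    ultimately show ?thesis by simp
  qed
qed

section \<open>Vertex degrees in ADE diagrams\<close>

lemma dynkin_degree_le_3:
  assumes "valid_dynkin t"
  shows "\<exists>a b c. {w. dynkin_arc t v w \<or> dynkin_arc t w v} \<subseteq> {a, b, c}"
proof (cases t)
  case (Dyn_A k)
  then show ?thesis
    by (intro exI[of _ "v + 1"] exI[of _ "v - 1"]) auto
next
  case (Dyn_D l)
  then show ?thesis
    using assms
    \<comment> \<open>Path edges lead only to \<open>v + 1\<close> and \<open>v - 1\<close>; the
      third candidate is the other end of the branch edge between \<open>l - 3\<close> and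
      \<open>l - 1\<close>. Candidates that are not neighbours do no harm, since only an inclusion
      is claimed. This covers the truncated \<open>v - 1\<close> at \<open>v = 0\<close>.\<close>
    by (intro exI[of _ "v + 1"] exI[of _ "v - 1"] exI[of _ "if v = l - 1 then l - 3 else l - 1"]) auto
next
  case (Dyn_E n)
  then show ?thesis
    using assms
    by (intro exI[of _ "v + 1"] exI[of _ "v - 1"] exI[of _ "if v = n - 1 then 2 else n - 1"]) auto
qed

text \<open>An edge never leaves its diagram. Thus all of \<open>L\<close> lies in the same diagram
  as \<open>c\<close> and comes from the at most three neighbours of the vertex of \<open>c\<close>.
  This is what rules out four leaves around \<open>C 0\<close>.\<close>

lemma graph_degree_le_3:
  assumes T: "graph_has_type V m T" and c: "c \<in> V"
    and L: "L \<subseteq> V" "c \<notin> L" and cL: "\<And>x. x \<in> L \<Longrightarrow> m c x = 1"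
  shows "card L \<le> 3"
proof -
  obtain ts \<phi> where ts: "mset ts = T" "bij_betw \<phi> (union_vertices ts) V"
    and m: "\<And>x y. x \<in> union_vertices ts \<Longrightarrow> y \<in> union_vertices ts \<Longrightarrow> x \<noteq> y \<Longrightarrow>
           m (\<phi> x) (\<phi> y) = union_edges ts x y"
    using T unfolding graph_has_type_def by blast
  have im: "\<phi> ` union_vertices ts = V"
    using ts(2) by (simp add: bij_betw_def)
  obtain i v where iv: "(i, v) \<in> union_vertices ts" "\<phi> (i, v) = c"
    using c im by (metis imageE surj_pair)
  then have "ts ! i \<in># T"
    using ts(1) by (auto simp: union_vertices_def)
  then have "valid_dynkin (ts ! i)"
    using T by (auto simp: graph_has_type_def)
  then obtain w1 w2 w3 where
    w: "{w. dynkin_arc (ts ! i) v w \<or> dynkin_arc (ts ! i) w v} \<subseteq> {w1, w2, w3}"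
    using dynkin_degree_le_3 by blast
  have "L \<subseteq> (\<lambda>w. \<phi> (i, w)) ` {w1, w2, w3}"
  proof
    fix x assume x: "x \<in> L"
    then obtain j w where jw: "(j, w) \<in> union_vertices ts" "\<phi> (j, w) = x"
      using L im by (metis imageE subsetD surj_pair)
    \<comment> \<open>The isomorphism describes \<open>m\<close> only off the diagonal; on the
      diagonal the intersection matrix has self-intersections. Here \<open>c \<notin> L\<close>
      keeps the two vertices apart.\<close>
    have "(i, v) \<noteq> (j, w)" using iv jw x L by auto
    then have "union_edges ts (i, v) (j, w) = 1"
      using m[OF iv(1) jw(1)] cL[OF x] iv jw by simp
    then have "j = i" "w \<in> {w1, w2, w3}"
      using w by (auto simp: union_edges_def split: if_splits)
    with jw show "x \<in> (\<lambda>w. \<phi> (i, w)) ` {w1, w2, w3}" by blast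
  qed
  then have "card L \<le> card ((\<lambda>w. \<phi> (i, w)) ` {w1, w2, w3})"
    by (intro card_mono) auto
  also have "\<dots> \<le> card {w1, w2, w3}"
    by (rule card_image_le) simp
  also have "\<dots> \<le> 3"
    by (simp add: card_insert_if)
  finally show ?thesis .
qed


section \<open>Curves in a fiber of type \<open>I\<^sub>0\<^sup>*\<close>\<close>

text \<open>If two closed sets cover an irreducible \<open>Z\<close>, one of them already contains
  it. The other one then either meets \<open>Z\<close> inside the first or misses \<open>Z\<close>,
  so the two do not separate \<open>Z\<close>.\<close>

lemma connectedin_irreducible_set:
  assumes "irreducible_set Z" "Z \<subseteq> topspace zariski"
  shows "connectedin zariski Z"
  unfolding connectedin_closedin using assms unfolding irreducible_set_def by blast

lemma minus_two_curve_connectedin: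
  assumes "minus_two_curve X D"
  shows "connectedin zariski D"
proof -
  have "projective_variety D"
    using assms by (simp add: minus_two_curve_def smooth_rational_curve_on_def curve_on_def)
  then show ?thesis
    unfolding projective_variety_def
    by (blast intro: connectedin_irreducible_set dest: closedin_subset)
qed

section \<open>Intersection numbers of distinct curves\<close>

lemma local_intersection_commute:
  "local_intersection X C D p = local_intersection X D C p"
proof -
  have "{\<lambda>q. u q + v q | u v. u \<in> ideal_at X C p \<and> v \<in> ideal_at X D p} =
        {\<lambda>q. u q + v q | u v. u \<in> ideal_at X D p \<and> v \<in> ideal_at X C p}"
    by (metis (no_types, opaque_lifting) add.commute)
  then show ?thesis by (simp add: local_intersection_def)
qed

text \<open>Transversality is given only with \<open>C 0\<close> as the first curve, while a graph
  isomorphism tests both orders. Symmetry comes from the sum of the two local ideals being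
  symmetric.\<close>

lemma intersection_number_commute:
  "intersection_number X C D = intersection_number X D C"
  by (simp add: intersection_number_def proper_intersection_def Int_commute
      local_intersection_commute[of X C D])

lemma intersection_number_disjoint:
  assumes "C \<noteq> D" "C \<inter> D = {}"
  shows "intersection_number X C D = 0"
  using assms by (simp add: intersection_number_def proper_intersection_def)

text \<open>Distinctness selects the proper intersection, which is then a sum with one summand, of
  local value 1.\<close>

lemma intersection_number_transversal:
  assumes "C \<noteq> D" "meet_transversely_once X C D"
  shows "intersection_number X C D = 1"
proof -
  obtain p where "C \<inter> D = {p}" "local_intersection X C D p = 1"
    using assms(2) by (auto simp: meet_transversely_once_def)
  then show ?thesis
    using assms(1) by (simp add: intersection_number_def proper_intersection_def one_enat_def)
qed

section \<open>Reduced divisors given by sets of curves\<close>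

definition reduced_divisor :: "'k pt set set \<Rightarrow> 'k divisor" where
  "reduced_divisor S D = of_bool (D \<in> S)"

lemma divisor_components_reduced_divisor [simp]:
  "divisor_components (reduced_divisor S) = S"
  by (auto simp: divisor_components_def reduced_divisor_def)

text \<open>Multiplicities are natural numbers, so every component of \<open>E\<close> has
  multiplicity at least 1, and inclusion of components already gives the subdivisor condition. This
  turns a set of curves of known graph type into an ADER.\<close>

lemma ADER_reduced_divisor:
  assumes "S \<noteq> {}" "S \<subseteq> divisor_components E" "\<And>D. D \<in> S \<Longrightarrow> minus_two_curve X D"
    and "graph_has_type S (intersection_number X) T"
  shows "ADER X E (reduced_divisor S)" "divisor_has_type X (reduced_divisor S) T"
proof -
  show T: "divisor_has_type X (reduced_divisor S) T"
    using assms(4) by (simp add: divisor_has_type_def)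
  have "reduced_divisor S \<noteq> (\<lambda>_. 0)"
    using assms(1) by (auto simp: reduced_divisor_def fun_eq_iff)
  moreover have "reduced_divisor S D \<le> 1 \<and> reduced_divisor S D \<le> E D" for D
    using assms(2) by (auto simp: reduced_divisor_def divisor_components_def)
  ultimately show "ADER X E (reduced_divisor S)"
    using T assms(3) by (auto simp: ADER_def)
qed

section \<open>Components of the fiber and their dual graph\<close>

context
  fixes X :: "'k::field pt set" and F :: "'k divisor" and C :: "nat \<Rightarrow> 'k pt set"
  assumes I0: "kodaira_I0_star X F C"
begin

lemma I0_star_multiplicity:
  "F D = 2 * of_bool (D = C 0) + (\<Sum>i=1..4. of_bool (D = C i))"
  using I0 unfolding kodaira_I0_star_def by metis

lemma I0_star_components: "divisor_components F = insert (C 0) (C ` {1..4})"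
proof -
  have "F D \<noteq> 0 \<longleftrightarrow> D = C 0 \<or> D \<in> C ` {1..4}" for D
    unfolding I0_star_multiplicity by (auto simp: image_iff)
  then show ?thesis by (auto simp only: divisor_components_def)
qed

lemma I0_star_inj: "inj_on C {0..4}"
  using I0 unfolding kodaira_I0_star_def by (elim conjE)

lemma I0_star_minus_two_curve:
  assumes "D \<in> divisor_components F"
  shows "minus_two_curve X D"
proof -
  have "\<forall>i\<in>{0..4}. minus_two_curve X (C i)"
    using I0 unfolding kodaira_I0_star_def by (elim conjE)
  moreover obtain i where "i \<in> {0..4}" "D = C i"
    using assms unfolding I0_star_components by force
  ultimately show ?thesis by blast
qed

lemma I0_star_center_not_leaf: "C 0 \<notin> C ` {1..4}"
proof
  assume "C 0 \<in> C ` {1..4}"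
  then obtain i where "i \<in> {1..4}" "C 0 = C i" by blast
  then show False
    using inj_onD[OF I0_star_inj, of 0 i] by simp
qed

lemma I0_star_card_leaves: "card (C ` {1..4}) = 4"
proof -
  have "inj_on C {1..4}"
    using I0_star_inj by (rule inj_on_subset) auto
  then show ?thesis by (simp add: card_image)
qed

lemma I0_star_leaves_disjoint:
  assumes "A \<in> C ` {1..4}" "B \<in> C ` {1..4}" "A \<noteq> B"
  shows "A \<inter> B = {}"
proof -
  have "\<forall>i\<in>{1..4}. \<forall>j\<in>{1..4}. i \<noteq> j \<longrightarrow> C i \<inter> C j = {}"
    using I0 unfolding kodaira_I0_star_def by (elim conjE)
  moreover obtain i j where "i \<in> {1..4}" "j \<in> {1..4}" "A = C i" "B = C j"
    using assms by blast
  moreover from this have "i \<noteq> j" using assms(3) by blast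
  ultimately show ?thesis by blast
qed

lemma I0_star_leaves_intersection:
  assumes "A \<in> C ` {1..4}" "B \<in> C ` {1..4}" "A \<noteq> B"
  shows "intersection_number X A B = 0"
  using assms by (intro intersection_number_disjoint I0_star_leaves_disjoint)

lemma I0_star_center_meets:
  assumes "A \<in> C ` {1..4}"
  shows "meet_transversely_once X (C 0) A"
proof -
  have "\<forall>i\<in>{1..4}. meet_transversely_once X (C 0) (C i)"
    using I0 unfolding kodaira_I0_star_def by (elim conjE)
  with assms show ?thesis by blast
qed

lemma I0_star_center_intersection:
  assumes "A \<in> C ` {1..4}"
  shows "intersection_number X (C 0) A = 1 \<and> intersection_number X A (C 0) = 1"
proof -
  have "C 0 \<noteq> A" using assms I0_star_center_not_leaf by blast
  then have "intersection_number X (C 0) A = 1"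
    using assms I0_star_center_meets intersection_number_transversal by blast
  then show ?thesis using intersection_number_commute[of X A] by simp
qed

lemma I0_star_leaves_type:
  assumes "L \<subseteq> C ` {1..4}"
  shows "graph_has_type L (intersection_number X) (replicate_mset (card L) (Dyn_A 1))"
proof (rule graph_has_type_discrete)
  show "finite L" using assms by (rule finite_subset) simp
  show "intersection_number X A B = 0" if "A \<in> L" "B \<in> L" "A \<noteq> B" for A B
    using that assms by (intro I0_star_leaves_intersection) auto
qed

text \<open>The curves in \<open>L\<close> are pairwise disjoint and each meets \<open>C 0\<close>
  with number 1, so the dual graph is a star centred at \<open>C 0\<close>.\<close>

lemma I0_star_center_type:
  assumes "L \<subseteq> C ` {1..4}" "card L \<le> 3"
  shows "graph_has_type (insert (C 0) L) (intersection_number X)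
           {#if card L = 3 then Dyn_D 4 else Dyn_A (card L + 1)#}"
proof (rule graph_has_type_star)
  show "finite L" using assms(1) by (rule finite_subset) simp
  show "C 0 \<notin> L" using assms(1) I0_star_center_not_leaf by blast
  show "intersection_number X (C 0) A = 1 \<and> intersection_number X A (C 0) = 1" if "A \<in> L" for A
    using that assms(1) I0_star_center_intersection by blast
  show "intersection_number X A B = 0" if "A \<in> L" "B \<in> L" "A \<noteq> B" for A B
    using that assms(1) by (intro I0_star_leaves_intersection) auto
qed fact

section \<open>Types of the ADERs in the fiber\<close>

lemma I0_star_ADER_components:
  assumes "ADER X F R"
  shows "divisor_components R \<noteq> {}" "divisor_components R \<subseteq> insert (C 0) (C ` {1..4})"
proof -
  show "divisor_components R \<noteq> {}"
    using assms by (auto simp: ADER_def divisor_components_def)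
  have "divisor_components R \<subseteq> divisor_components F"
    using assms by (auto simp: ADER_def divisor_components_def) (metis le_zero_eq not_gr_zero)
  then show "divisor_components R \<subseteq> insert (C 0) (C ` {1..4})"
    unfolding I0_star_components .
qed

lemma I0_star_ADER_center:
  assumes R: "ADER X F R" and 0: "C 0 \<in> divisor_components R"
  shows "connectedin zariski (divisor_support R)"
    and "divisor_has_type X R {#Dyn_D 4#} \<or> (\<exists>t\<in>{1..3}. divisor_has_type X R {#Dyn_A t#})"
proof -
  define L where "L = divisor_components R - {C 0}"
  have L: "L \<subseteq> C ` {1..4}" "C 0 \<notin> L" and ins: "divisor_components R = insert (C 0) L"
    using I0_star_ADER_components[OF R] 0 by (auto simp: L_def)
  obtain T where "divisor_has_type X R T"
    using R by (auto simp: ADER_def)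
  then have "graph_has_type (insert (C 0) L) (intersection_number X) T"
    by (simp add: divisor_has_type_def ins)
  \<comment> \<open>The ADE type \<open>T\<close> coming with \<open>R\<close> serves only to bound
    the number of neighbours of \<open>C 0\<close>. The actual type is then read off from the
    star.\<close>
  then have card: "card L \<le> 3"
    by (rule graph_degree_le_3) (use L I0_star_center_intersection in auto)
  from I0_star_center_type[OF L(1) card]
  have "divisor_has_type X R {#if card L = 3 then Dyn_D 4 else Dyn_A (card L + 1)#}"
    by (simp add: divisor_has_type_def ins)
  \<comment> \<open>Outside the \<open>D_4\<close> case there are at most two leaves, so
    \<open>t = card L + 1\<close>, which counts the centre as well, is at most 3.\<close>
  then show "divisor_has_type X R {#Dyn_D 4#} \<or> (\<exists>t\<in>{1..3}. divisor_has_type X R {#Dyn_A t#})"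
    using card by (cases "card L = 3") (auto intro!: bexI[of _ "card L + 1"])
  have con: "connectedin zariski D" if "D \<in> divisor_components R" for D
    using that I0_star_ADER_components(2)[OF R] I0_star_minus_two_curve minus_two_curve_connectedin
    unfolding I0_star_components by blast
  have meet: "C 0 \<inter> D \<noteq> {}" if "D \<in> L" for D
    using that L(1) I0_star_center_meets[of D] by (auto simp: meet_transversely_once_def)
  \<comment> \<open>Adding \<open>C 0\<close> to every leaf gives connected sets that all share the
    points of \<open>C 0\<close>, so their union is connected. The separate \<open>C 0\<close> takes
    care of an empty \<open>L\<close>.\<close>
  have sup: "divisor_support R = C 0 \<union> \<Union>((\<lambda>D. C 0 \<union> D) ` L)"
    by (auto simp: divisor_support_def ins)
  show "connectedin zariski (divisor_support R)"
  proof (cases "L = {}")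
    case True
    then show ?thesis using con[OF 0] by (simp add: sup)
  next
    case False
    then obtain D where "D \<in> L" by blast
    have "connectedin zariski (\<Union>((\<lambda>D. C 0 \<union> D) ` L))"
    proof (rule connectedin_Union)
      show "connectedin zariski S" if "S \<in> (\<lambda>D. C 0 \<union> D) ` L" for S
        using that con meet by (auto simp: ins intro!: connectedin_Un)
      show "\<Inter>((\<lambda>D. C 0 \<union> D) ` L) \<noteq> {}"
        using meet[OF \<open>D \<in> L\<close>] by blast
    qed
    moreover have "divisor_support R = \<Union>((\<lambda>D. C 0 \<union> D) ` L)"
      using False by (auto simp: sup)
    ultimately show ?thesis by simp
  qed
qed

text \<open>Without the centre all components are leaves, which are disjoint, and \<open>s\<close>
  is their number. It is positive because \<open>R\<close> is nonzero and at most 4 because the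
  fiber has four leaves.\<close>

lemma I0_star_ADER_leaves:
  assumes R: "ADER X F R" and 0: "C 0 \<notin> divisor_components R"
  shows "divisor_components R \<subseteq> C ` {1..4}"
    and "pairwise disjnt (divisor_components R)"
    and "\<exists>s\<in>{1..4}. divisor_has_type X R (replicate_mset s (Dyn_A 1))"
proof -
  show L: "divisor_components R \<subseteq> C ` {1..4}"
    using I0_star_ADER_components(2)[OF R] 0 by blast
  show "pairwise disjnt (divisor_components R)"
    unfolding pairwise_def disjnt_def
  proof (intro ballI impI)
    fix A B
    assume "A \<in> divisor_components R" "B \<in> divisor_components R" "A \<noteq> B"
    with L show "A \<inter> B = {}" by (intro I0_star_leaves_disjoint subsetD[OF L])
  qed
  have "card (divisor_components R) \<le> 4"
    using card_mono[OF _ L] I0_star_card_leaves by simp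
  moreover have "card (divisor_components R) \<noteq> 0"
    using I0_star_ADER_components(1)[OF R] finite_subset[OF L] by simp
  ultimately show "\<exists>s\<in>{1..4}. divisor_has_type X R (replicate_mset s (Dyn_A 1))"
    using I0_star_leaves_type[OF L] unfolding divisor_has_type_def
    by (intro bexI[of _ "card (divisor_components R)"]) auto
qed

section \<open>Realization of every type\<close>

lemma I0_star_ex_center:
  assumes "n \<le> 3"
  shows "\<exists>R. ADER X F R \<and> C 0 \<in> divisor_components R \<and>
           divisor_has_type X R {#if n = 3 then Dyn_D 4 else Dyn_A (n + 1)#}"
proof -
  \<comment> \<open>Any \<open>n\<close> leaves will do: together with \<open>C 0\<close> they give
    \<open>A_1\<close>, \<open>A_2\<close>, \<open>A_3\<close>, \<open>D_4\<close> for
    \<open>n = 0, 1, 2, 3\<close>.\<close>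
  obtain L where L: "L \<subseteq> C ` {1..4}" "card L = n"
    using obtain_subset_with_card_n[of n "C ` {1..4}"] assms I0_star_card_leaves by auto
  have "graph_has_type (insert (C 0) L) (intersection_number X)
          {#if n = 3 then Dyn_D 4 else Dyn_A (n + 1)#}"
    using I0_star_center_type[OF L(1)] assms unfolding L(2) by blast
  moreover have "insert (C 0) L \<subseteq> divisor_components F"
    using L by (auto simp: I0_star_components)
  ultimately have "ADER X F (reduced_divisor (insert (C 0) L))"
    "divisor_has_type X (reduced_divisor (insert (C 0) L))
       {#if n = 3 then Dyn_D 4 else Dyn_A (n + 1)#}"
    using I0_star_minus_two_curve by (blast intro: ADER_reduced_divisor)+
  then show ?thesis
    by (intro exI[of _ "reduced_divisor (insert (C 0) L)"] conjI) simp_all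
qed

lemma I0_star_ex_leaves:
  assumes "s \<in> {1..4}"
  shows "\<exists>R. ADER X F R \<and> C 0 \<notin> divisor_components R \<and>
           divisor_has_type X R (replicate_mset s (Dyn_A 1))"
proof -
  obtain L where L: "L \<subseteq> C ` {1..4}" "card L = s"
    using obtain_subset_with_card_n[of s "C ` {1..4}"] assms I0_star_card_leaves by auto
  have "graph_has_type L (intersection_number X) (replicate_mset s (Dyn_A 1))"
    using I0_star_leaves_type[OF L(1)] L(2) by simp
  moreover have "L \<subseteq> divisor_components F" "L \<noteq> {}" "C 0 \<notin> L"
    using L assms I0_star_center_not_leaf by (auto simp: I0_star_components)
  ultimately have "ADER X F (reduced_divisor L)"
    "divisor_has_type X (reduced_divisor L) (replicate_mset s (Dyn_A 1))"
    using I0_star_minus_two_curve by (blast intro: ADER_reduced_divisor)+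
  with \<open>C 0 \<notin> L\<close> show ?thesis
    by (intro exI[of _ "reduced_divisor L"] conjI) simp_all
qed

end

theorem proposition10p1:
  fixes X :: "'k::{alg_closed_field, field_char_0} pt set"
    and g :: "'k pt \<Rightarrow> 'k pt" and b :: "'k pt"
    and F :: "'k divisor" and C :: "nat \<Rightarrow> 'k pt set"
  assumes "K3_surface X"
    and "elliptic_fibration X g"
    and "b \<in> proj_space 1"
    and "F = fiber_divisor X g b"
    and "kodaira_I0_star X F C"
  shows "(\<forall>R. ADER X F R \<longrightarrow>
            divisor_has_type X R {#Dyn_D 4#} \<or> divisor_has_type X R {#Dyn_A 3#} \<or>
            divisor_has_type X R {#Dyn_A 2#} \<or>
            (\<exists>s\<in>{1..4}. divisor_has_type X R (replicate_mset s (Dyn_A 1))))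
       \<and> (\<forall>R. ADER X F R \<and> C 0 \<in> divisor_components R \<longrightarrow>
            connectedin zariski (divisor_support R) \<and>
            (divisor_has_type X R {#Dyn_D 4#} \<or>
             (\<exists>t\<in>{1..3}. divisor_has_type X R {#Dyn_A t#})))
       \<and> (\<forall>R. ADER X F R \<and> C 0 \<notin> divisor_components R \<longrightarrow>
            divisor_components R \<subseteq> C ` {1..4} \<and> pairwise disjnt (divisor_components R) \<and>
            (\<exists>s\<in>{1..4}. divisor_has_type X R (replicate_mset s (Dyn_A 1))))
       \<and> (\<exists>R. ADER X F R \<and> C 0 \<in> divisor_components R \<and> divisor_has_type X R {#Dyn_D 4#})
       \<and> (\<forall>t\<in>{1..3}. \<exists>R. ADER X F R \<and> C 0 \<in> divisor_components R \<and> divisor_has_type X R {#Dyn_A t#})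
       \<and> (\<forall>s\<in>{1..4}. \<exists>R. ADER X F R \<and> C 0 \<notin> divisor_components R \<and>
            divisor_has_type X R (replicate_mset s (Dyn_A 1)))"
proof (intro conjI allI impI ballI; (elim conjE)?)
  note I0 = \<open>kodaira_I0_star X F C\<close>
  note center = I0_star_ADER_center[OF I0] and leaves = I0_star_ADER_leaves[OF I0]
  show "divisor_has_type X R {#Dyn_D 4#} \<or> divisor_has_type X R {#Dyn_A 3#} \<or>
      divisor_has_type X R {#Dyn_A 2#} \<or>
      (\<exists>s\<in>{1..4}. divisor_has_type X R (replicate_mset s (Dyn_A 1)))" if R: "ADER X F R" for R
  proof (cases "C 0 \<in> divisor_components R")
    case True
    \<comment> \<open>The case \<open>t = 1\<close>, where \<open>R\<close> is \<open>C 0\<close>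
      alone, falls under the sums of \<open>A_1\<close> with \<open>s = 1\<close>.\<close>
    have "\<exists>s\<in>{1..4}. divisor_has_type X R (replicate_mset s (Dyn_A 1))"
      if "divisor_has_type X R {#Dyn_A 1#}"
      using that by (intro bexI[of _ 1]) auto
    moreover have "{1..3} = {1, 2, 3::nat}" by auto
    ultimately show ?thesis using center(2)[OF R True] by auto
  next
    case False
    then show ?thesis using leaves(3)[OF R] by blast
  qed
  show "connectedin zariski (divisor_support R)"
    "divisor_has_type X R {#Dyn_D 4#} \<or> (\<exists>t\<in>{1..3}. divisor_has_type X R {#Dyn_A t#})"
    if "ADER X F R" "C 0 \<in> divisor_components R" for R
    using center[OF that] by blast+
  show "divisor_components R \<subseteq> C ` {1..4}" "pairwise disjnt (divisor_components R)"
    "\<exists>s\<in>{1..4}. divisor_has_type X R (replicate_mset s (Dyn_A 1))"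
    if "ADER X F R" "C 0 \<notin> divisor_components R" for R
    using leaves[OF that] by blast+
  show "\<exists>R. ADER X F R \<and> C 0 \<in> divisor_components R \<and> divisor_has_type X R {#Dyn_D 4#}"
    using I0_star_ex_center[OF I0, of 3] by simp
  show "\<exists>R. ADER X F R \<and> C 0 \<in> divisor_components R \<and> divisor_has_type X R {#Dyn_A t#}"
    if "t \<in> {1..3}" for t
  proof -
    \<comment> \<open>Type \<open>A_t\<close> consists of the centre and \<open>t - 1\<close>
      leaves. The subtraction is exact since \<open>t \<ge> 1\<close>, and
      \<open>t - 1 \<noteq> 3\<close> selects the \<open>A\<close> branch of the
      conditional.\<close>
    from that have "t - 1 \<le> 3" "t - 1 \<noteq> 3" "t - 1 + 1 = t" by auto
    then show ?thesis using I0_star_ex_center[OF I0, of "t - 1"] by simp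
  qed
  show "\<exists>R. ADER X F R \<and> C 0 \<notin> divisor_components R \<and>
      divisor_has_type X R (replicate_mset s (Dyn_A 1))" if "s \<in> {1..4}" for s
    using I0_star_ex_leaves[OF I0 that] .
qed

end
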